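(* Let $p$ be a prime number, let $F$ be the field with $p$ elements, and let $V$ be an $F$-vector space of finite dimension $n>0$. Suppose $H$ and $K$ are abelian subgroups of $\mathrm{GL}(V)$ such that $\mathrm{Hol}(V,H)\cong\mathrm{Hol}(V,K)$ as groups. Then $H\cong K$.
   Context: For a group $G$ and a subgroup $H$ of $\mathrm{Aut}(G)$, the relative holomorph $\mathrm{Hol}(G,H)=G\rtimes H$ is the semidirect product in which $h g h^{-1}=h(g)$ for $h\in H$, $g\in G$. Here it is applied to the additive group of $V$, with $\mathrm{GL}(V)=\mathrm{Aut}(V)$. *)

theory Defs
  imports
    "HOL-Algebra.Bij"
    "HOL-Computational_Algebra.Primes"
    "Jordan_Normal_Form.Missing_VectorSpace"
begin

text \<open>
  \<open>rel_holomorph G H\<close> is the relative holomorph \<open>Hol(G, H) = G \<rtimes> H\<close>; it is intended for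
  a group \<open>G\<close> and a subgroup \<open>H\<close> of \<open>AutoGroup G\<close>. The pair \<open>(g, h)\<close> represents the product
  \<open>g h\<close>, so the multiplication is forced by \<open>h g h\<inverse> = h(g)\<close>
  (see \<open>rel_holomorph_conj\<close> below).
\<close>

definition rel_holomorph ::
    "('a, 'm) monoid_scheme \<Rightarrow> ('a \<Rightarrow> 'a) set \<Rightarrow> ('a \<times> ('a \<Rightarrow> 'a)) monoid" where
  "rel_holomorph G H =
     \<lparr>carrier = carrier G \<times> H,
      monoid.mult = \<lambda>(g, h) (g', h'). (g \<otimes>\<^bsub>G\<^esub> h g', h \<otimes>\<^bsub>AutoGroup G\<^esub> h'),
      monoid.one = (\<one>\<^bsub>G\<^esub>, \<one>\<^bsub>AutoGroup G\<^esub>)\<rparr>"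

text \<open>
  As for \<open>AutoGroup\<close>, the elements of \<open>general_linear_group F V\<close> are extensional functions
  (\<open>undefined\<close> outside \<open>carrier V\<close>), so that equal maps on \<open>V\<close> are equal elements.
\<close>

definition general_linear_group ::
    "('f, 'k) ring_scheme \<Rightarrow> ('f, 'v, 'm) module_scheme \<Rightarrow> ('v \<Rightarrow> 'v) monoid" where
  "general_linear_group F V =
     BijGroup (carrier V) \<lparr>carrier := module_hom F V V \<inter> Bij (carrier V)\<rparr>"

lemma AutoGroup_simps:
  "carrier (AutoGroup G) = auto G"
  "h \<in> auto G \<Longrightarrow> h' \<in> auto G \<Longrightarrow> h \<otimes>\<^bsub>AutoGroup G\<^esub> h' = compose (carrier G) h h'"
  "\<one>\<^bsub>AutoGroup G\<^esub> = (\<lambda>x\<in>carrier G. x)"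
  by (auto simp: AutoGroup_def BijGroup_def auto_def)

lemma group_rel_holomorph:
  assumes "group G" "subgroup H (AutoGroup G)"
  shows "group (rel_holomorph G H)"
proof -
  interpret G: group G by fact
  interpret A: group "AutoGroup G" by (rule G.AutoGroup)
  interpret H: subgroup H "AutoGroup G" by fact
  have aut: "h \<in> auto G" if "h \<in> H" for h
    using H.subset that by (auto simp: AutoGroup_simps)
  have cl: "h x \<in> carrier G" if "h \<in> H" "x \<in> carrier G" for h x
    using aut[OF that(1)] that(2) by (auto simp: auto_def hom_def)
  have hm: "h (x \<otimes>\<^bsub>G\<^esub> y) = h x \<otimes>\<^bsub>G\<^esub> h y"
    if "h \<in> H" "x \<in> carrier G" "y \<in> carrier G" for h x y
    using aut[OF that(1)] that(2,3) by (auto simp: auto_def hom_def)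
  have mul: "(h \<otimes>\<^bsub>AutoGroup G\<^esub> h') x = h (h' x)"
    if "h \<in> H" "h' \<in> H" "x \<in> carrier G" for h h' x
    using aut[OF that(1)] aut[OF that(2)] that(3) by (simp add: AutoGroup_simps compose_eq)
  have one: "\<one>\<^bsub>AutoGroup G\<^esub> x = x" if "x \<in> carrier G" for x
    using that by (simp add: AutoGroup_simps)
  show ?thesis
  proof (rule groupI)
    fix x assume "x \<in> carrier (rel_holomorph G H)"
    then obtain g h where x: "x = (g, h)" "g \<in> carrier G" "h \<in> H"
      by (auto simp: rel_holomorph_def)
    let ?h = "inv\<^bsub>AutoGroup G\<^esub> h"
    have "?h \<in> H" using x by simp
    then have "(?h (inv\<^bsub>G\<^esub> g), ?h) \<in> carrier (rel_holomorph G H)"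
      using x by (auto simp: rel_holomorph_def cl)
    moreover have "(?h (inv\<^bsub>G\<^esub> g), ?h) \<otimes>\<^bsub>rel_holomorph G H\<^esub> x = \<one>\<^bsub>rel_holomorph G H\<^esub>"
    proof -
      have "?h (inv\<^bsub>G\<^esub> g) \<otimes>\<^bsub>G\<^esub> ?h g = ?h \<one>\<^bsub>G\<^esub>"
        using x \<open>?h \<in> H\<close> by (simp add: hm[symmetric])
      moreover have "?h \<one>\<^bsub>G\<^esub> \<otimes>\<^bsub>G\<^esub> ?h \<one>\<^bsub>G\<^esub> = ?h \<one>\<^bsub>G\<^esub>"
        using \<open>?h \<in> H\<close> by (simp add: hm[symmetric])
      then have "?h \<one>\<^bsub>G\<^esub> = \<one>\<^bsub>G\<^esub>"
        using \<open>?h \<in> H\<close> by (simp add: cl)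
      ultimately show ?thesis using x by (simp add: rel_holomorph_def)
    qed
    ultimately show "\<exists>y\<in>carrier (rel_holomorph G H). y \<otimes>\<^bsub>rel_holomorph G H\<^esub> x = \<one>\<^bsub>rel_holomorph G H\<^esub>"
      by blast
  qed (auto simp: rel_holomorph_def cl hm mul one G.m_assoc A.m_assoc)
qed

lemma rel_holomorph_conj:
  assumes "group G" "subgroup H (AutoGroup G)" "g \<in> carrier G" "h \<in> H"
  shows "(\<one>\<^bsub>G\<^esub>, h) \<otimes>\<^bsub>rel_holomorph G H\<^esub> (g, \<one>\<^bsub>AutoGroup G\<^esub>)
           \<otimes>\<^bsub>rel_holomorph G H\<^esub> inv\<^bsub>rel_holomorph G H\<^esub> (\<one>\<^bsub>G\<^esub>, h) = (h g, \<one>\<^bsub>AutoGroup G\<^esub>)"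
proof -
  interpret G: group G by fact
  interpret A: group "AutoGroup G" by (rule G.AutoGroup)
  interpret H: subgroup H "AutoGroup G" by fact
  interpret R: group "rel_holomorph G H" using assms by (intro group_rel_holomorph)
  have aut: "h \<in> auto G" using H.subset assms by (auto simp: AutoGroup_simps)
  then have "h g \<in> carrier G" "h \<one>\<^bsub>G\<^esub> \<in> carrier G" "h \<one>\<^bsub>G\<^esub> \<otimes>\<^bsub>G\<^esub> h \<one>\<^bsub>G\<^esub> = h \<one>\<^bsub>G\<^esub>"
    using assms by (auto simp: auto_def hom_def) (metis G.l_one G.one_closed)
  then have hg: "h g \<in> carrier G" and h1: "h \<one>\<^bsub>G\<^esub> = \<one>\<^bsub>G\<^esub>" by auto
  have "(\<one>\<^bsub>G\<^esub>, h) \<otimes>\<^bsub>rel_holomorph G H\<^esub> (g, \<one>\<^bsub>AutoGroup G\<^esub>)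
      = (h g, \<one>\<^bsub>AutoGroup G\<^esub>) \<otimes>\<^bsub>rel_holomorph G H\<^esub> (\<one>\<^bsub>G\<^esub>, h)"
    using assms hg by (simp add: rel_holomorph_def AutoGroup_simps(3))
      (use assms in \<open>simp add: AutoGroup_simps(3)[symmetric]\<close>)
  moreover have "(\<one>\<^bsub>G\<^esub>, h) \<in> carrier (rel_holomorph G H)"
    "(h g, \<one>\<^bsub>AutoGroup G\<^esub>) \<in> carrier (rel_holomorph G H)"
    using assms hg by (auto simp: rel_holomorph_def)
  ultimately show ?thesis by (simp add: R.m_assoc)
qed

lemma subgroup_general_linear_group:
  assumes "module F V"
  shows "subgroup (module_hom F V V \<inter> Bij (carrier V)) (AutoGroup (add_monoid V))"
proof -
  interpret module F V by fact
  interpret A: group "AutoGroup (add_monoid V)" by (rule M.add.AutoGroup)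
  have sub: "module_hom F V V \<inter> Bij (carrier V) \<subseteq> auto (add_monoid V)"
    by (auto simp: auto_def hom_def module_hom_def)
  show ?thesis
  proof (rule A.subgroupI)
    show "module_hom F V V \<inter> Bij (carrier V) \<subseteq> carrier (AutoGroup (add_monoid V))"
      using sub by (simp add: AutoGroup_simps)
    have "(\<lambda>x\<in>carrier V. x) \<in> module_hom F V V \<inter> Bij (carrier V)"
      by (auto simp: module_hom_def id_Bij)
    then show "module_hom F V V \<inter> Bij (carrier V) \<noteq> {}" by blast
  next
    fix f assume f: "f \<in> module_hom F V V \<inter> Bij (carrier V)"
    then have bij: "bij_betw f (carrier V) (carrier V)" by (auto simp: Bij_def)
    let ?f = "restrict (inv_into (carrier V) f) (carrier V)"
    have fa: "f \<in> auto (add_monoid V)" using f sub by blast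
    have inv: "inv\<^bsub>AutoGroup (add_monoid V)\<^esub> f = ?f"
    proof (rule A.inv_equality)
      have fB: "?f \<in> auto (add_monoid V)"
        using fa M.add.restrict_inv_into_hom[of f] restrict_inv_into_Bij[of f "carrier V"]
        by (auto simp: auto_def)
      then show "?f \<in> carrier (AutoGroup (add_monoid V))" by (simp add: AutoGroup_simps)
      show "?f \<otimes>\<^bsub>AutoGroup (add_monoid V)\<^esub> f = \<one>\<^bsub>AutoGroup (add_monoid V)\<^esub>"
        using fa fB f Bij_compose_restrict_eq[of f "carrier V"] by (simp add: AutoGroup_simps)
    qed (use fa in \<open>simp add: AutoGroup_simps\<close>)
    have mem: "inv_into (carrier V) f x \<in> carrier V" "f (inv_into (carrier V) f x) = x"
      if "x \<in> carrier V" for x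
      using bij that by (auto simp: bij_betw_def inv_into_into f_inv_into_f)
    have eqI: "inv_into (carrier V) f x = y" if "y \<in> carrier V" "f y = x" for x y
      using bij that by (auto simp: bij_betw_def inv_into_f_f)
    have "?f \<in> module_hom F V V"
      using f by (auto simp: module_hom_def mem intro!: eqI)
    moreover have "?f \<in> Bij (carrier V)" using f by (auto intro: restrict_inv_into_Bij)
    ultimately show "inv\<^bsub>AutoGroup (add_monoid V)\<^esub> f \<in> module_hom F V V \<inter> Bij (carrier V)"
      unfolding inv by blast
  next
    fix f g assume fg: "f \<in> module_hom F V V \<inter> Bij (carrier V)"
      "g \<in> module_hom F V V \<inter> Bij (carrier V)"
    then have "f \<in> auto (add_monoid V)" "g \<in> auto (add_monoid V)"
      using sub by blast+
    then have "f \<otimes>\<^bsub>AutoGroup (add_monoid V)\<^esub> g = compose (carrier V) f g"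
      by (simp add: AutoGroup_simps)
    moreover have "compose (carrier V) f g \<in> module_hom F V V"
      using fg by (auto simp: module_hom_def compose_def Pi_iff)
    moreover have "compose (carrier V) f g \<in> Bij (carrier V)"
      using fg by (auto intro: compose_Bij)
    ultimately show "f \<otimes>\<^bsub>AutoGroup (add_monoid V)\<^esub> g \<in> module_hom F V V \<inter> Bij (carrier V)"
      by simp
  qed
qed

lemma general_linear_group_eq:
  "general_linear_group F V =
     AutoGroup (add_monoid V) \<lparr>carrier := module_hom F V V \<inter> Bij (carrier V)\<rparr>"
  by (simp add: general_linear_group_def AutoGroup_def)

lemma group_general_linear_group:
  assumes "module F V"
  shows "group (general_linear_group F V)"
proof -
  interpret module F V by fact
  show ?thesis
    unfolding general_linear_group_eq
    by (intro subgroup.subgroup_is_group subgroup_general_linear_group assms M.add.AutoGroup)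
qed

lemma subgroup_general_linear_imp_subgroup_AutoGroup:
  assumes "module F V" "subgroup H (general_linear_group F V)"
  shows "subgroup H (AutoGroup (add_monoid V))"
proof -
  interpret module F V by fact
  show ?thesis
    using group.incl_subgroup[OF M.add.AutoGroup subgroup_general_linear_group[OF assms(1)]]
      assms(2) unfolding general_linear_group_eq by blast
qed

end

theory Submission
  imports "HOL-Algebra.Multiplicative_Group" Defs
begin

text \<open>Identify both holomorphs with one group \<open>G = V \<rtimes> H = W \<rtimes> K\<close>. As \<open>H\<close> and \<open>K\<close> are abelian
  retracts of \<open>G\<close>, they embed into the abelianization \<open>Q\<close> of \<open>G\<close>, and since \<open>V\<close> and \<open>W\<close> have
  exponent \<open>p\<close>, the images \<open>H'\<close> and \<open>K'\<close> satisfy \<open>Q = Q[p] H' = Q[p] K'\<close>. Having equal order, they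
  admit a common complement \<open>C \<subseteq> Q[p]\<close>, so both are isomorphic to \<open>Q / C\<close>.\<close>

section \<open>Complements of subgroups in abelian groups\<close>

text \<open>If \<open>x\<close> in \<open>S\<close> avoids \<open>A\<close> and \<open>y\<close> in
  \<open>S\<close> avoids \<open>B\<close>, then \<open>x\<close> lies in \<open>B\<close> and
  \<open>y\<close> in \<open>A\<close>. The product \<open>x \<otimes> y\<close> lies in
  \<open>A\<close> or \<open>B\<close>, and cancelling the factor already there contradicts the
  choice of the other.\<close>

lemma (in group) subgroup_subset_Un:
  assumes S: "subgroup S G" and A: "subgroup A G" and B: "subgroup B G" and "S \<subseteq> A \<union> B"
  shows "S \<subseteq> A \<or> S \<subseteq> B"
proof (rule ccontr)
  assume "\<not> ?thesis"
  then obtain x y where x: "x \<in> S" "x \<notin> A" and y: "y \<in> S" "y \<notin> B" by blast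
  with assms(4) have xB: "x \<in> B" and yA: "y \<in> A" by auto
  have car: "x \<in> carrier G" "y \<in> carrier G"
    using x y subgroup.mem_carrier[OF S] by auto
  have "x \<otimes> y \<in> A \<union> B"
    using x y S assms(4) by (auto dest: subgroup.m_closed)
  then show False
  proof
    assume "x \<otimes> y \<in> A"
    then have "x \<otimes> y \<otimes> inv y \<in> A"
      using yA A by (simp add: subgroup.m_closed subgroup.m_inv_closed)
    then show False using x car by (simp add: m_assoc)
  next
    assume "x \<otimes> y \<in> B"
    then have "inv x \<otimes> (x \<otimes> y) \<in> B"
      using xB B by (simp add: subgroup.m_closed subgroup.m_inv_closed)
    then show False using y car by (simp add: m_assoc[symmetric])
  qed
qed

lemma (in group) card_set_mult_disjoint:
  assumes A: "subgroup A G" and B: "subgroup B G" and "A \<inter> B = {\<one>}"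
  shows "card (A <#> B) = card A * card B"
proof -
  interpret group_disjoint_sum G A B
    using A B by (intro group_disjoint_sum.intro is_group)
  have "inj_on (\<lambda>(a, b). a \<otimes> b) (A \<times> B)"
    using cancel assms(3) by (fastforce simp: inj_on_def)
  then have "card ((\<lambda>(a, b). a \<otimes> b) ` (A \<times> B)) = card A * card B"
    by (simp add: card_image card_cartesian_product)
  moreover have "(\<lambda>(a, b). a \<otimes> b) ` (A \<times> B) = A <#> B"
    by (auto simp: set_mult_def)
  ultimately show ?thesis by simp
qed

text \<open>The projection modulo \<open>C\<close>, restricted to \<open>H\<close>, is injective
  because \<open>C\<close> meets \<open>H\<close> trivially and surjective because \<open>C\<close>
  and \<open>H\<close> generate the group. Two subgroups with a common complement are therefore
  isomorphic to one and the same quotient.\<close>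

lemma (in comm_group) complement_iso_FactGroup:
  assumes C: "subgroup C G" and H: "subgroup H G"
    and int: "C \<inter> H = {\<one>}" and prod: "C <#> H = carrier G"
  shows "G\<lparr>carrier := H\<rparr> \<cong> G Mod C"
proof -
  interpret C: normal C G using C by (rule subgroup_imp_normal)
  have sub: "h \<in> carrier G" if "h \<in> H" for h using subgroup.mem_carrier[OF H that] .
  have subC: "c \<in> carrier G" if "c \<in> C" for c using subgroup.mem_carrier[OF C that] .
  have "(\<lambda>h. C #> h) \<in> hom (G\<lparr>carrier := H\<rparr>) (G Mod C)"
    using C.r_coset_hom_Mod sub by (auto simp: hom_def)
  moreover have "inj_on (\<lambda>h. C #> h) H"
  proof (rule inj_onI)
    fix h k assume hk: "h \<in> H" "k \<in> H" "C #> h = C #> k"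
    then have "h \<in> C #> k" using rcos_self[OF _ C.subgroup_axioms] sub by blast
    then have "h \<otimes> inv k \<in> C"
      using C.rcos_module_imp[OF is_group] hk sub by simp
    moreover have "h \<otimes> inv k \<in> H"
      using hk H by (simp add: subgroup.m_closed subgroup.m_inv_closed)
    ultimately have "h \<otimes> inv k = \<one>" using int by blast
    then show "h = k" using inv_equality[of h "inv k"] hk sub by simp
  qed
  moreover have "(\<lambda>h. C #> h) ` H = carrier (G Mod C)"
  proof -
    have "C #> g \<in> (\<lambda>h. C #> h) ` H" if "g \<in> carrier G" for g
    proof -
      have "g \<in> C <#> H" using that by (simp only: prod)
      then obtain c h where ch: "c \<in> C" "h \<in> H" "g = c \<otimes> h"
        unfolding set_mult_def by blast
      have "C #> c = C" using ch(1) subC by (simp add: coset_join2 C.subgroup_axioms)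
      then have "C #> g = C #> h"
        using coset_mult_assoc[OF C.subset, of c h] ch subC sub by simp
      then show ?thesis using ch(2) by (rule image_eqI)
    qed
    then show ?thesis using sub by (auto simp: FactGroup_def RCOSETS_def)
  qed
  ultimately have "(\<lambda>h. C #> h) \<in> iso (G\<lparr>carrier := H\<rparr>) (G Mod C)"
    by (simp add: iso_def bij_betw_def)
  then show ?thesis unfolding is_iso_def by blast
qed

text \<open>The enlargement step for a maximality argument. If \<open>c \<otimes> x [^] k\<close>
  lies in \<open>H\<close>, then \<open>x [^] k\<close> lies in \<open>C <#> H\<close>. Were
  \<open>k\<close> prime to \<open>p\<close>, Bezout would make \<open>x\<close> a power of
  \<open>x [^] k\<close>, hence an element of \<open>C <#> H\<close>. So \<open>p\<close> divides
  \<open>k\<close>, the power of \<open>x\<close> vanishes, and \<open>c\<close> lies in the trivial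
  group \<open>C \<inter> H\<close>.\<close>

lemma (in comm_group) complement_extend:
  fixes p :: nat
  assumes p: "prime p" and C: "subgroup C G" and H: "subgroup H G" and int: "C \<inter> H = {\<one>}"
    and x: "x \<in> carrier G" "x [^] p = \<one>" "x \<notin> C <#> H"
  shows "(C <#> generate G {x}) \<inter> H = {\<one>}"
proof -
  have CH: "subgroup (C <#> H) G" using C H by (rule mult_subgroups)
  have gx: "subgroup (generate G {x}) G" using x by (simp add: generate_is_subgroup)
  have sub: "h \<in> carrier G" if "h \<in> H" for h using subgroup.mem_carrier[OF H that] .
  have subC: "h \<in> carrier G" if "h \<in> C" for h using subgroup.mem_carrier[OF C that] .
  have "c \<otimes> y = \<one>" if c: "c \<in> C" and y: "y \<in> generate G {x}" and h: "c \<otimes> y \<in> H" for c y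
  proof -
    obtain k :: int where k: "y = x [^] k" using y x by (auto simp: generate_pow)
    have "y = inv c \<otimes> (c \<otimes> y)" using c k x subC by (simp add: m_assoc[symmetric])
    then have yCH: "y \<in> C <#> H"
      unfolding set_mult_def using c h subgroup.m_inv_closed[OF C] by blast
    have xp: "x [^] (int p * j) = \<one>" for j
      using x by (simp add: int_pow_pow[symmetric] int_pow_int)
    have "int p dvd k"
    proof (rule ccontr)
      assume "\<not> int p dvd k"
      then have "coprime (int p) k" using p by (simp add: prime_imp_coprime)
      then obtain u v where "u * int p + v * k = 1"
        using bezout_int[of "int p" k] by (auto simp: coprime_iff_gcd_eq_1)
      then have "x = x [^] (int p * u + k * v)" using x by (simp add: mult.commute)
      also have "\<dots> = y [^] v"
        using x by (simp add: int_pow_mult xp k int_pow_pow)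
      finally have "x = y [^] v" .
      moreover have "y [^] v \<in> C <#> H"
        using subgroup_int_pow_closed[OF CH yCH] .
      ultimately show False using x by simp
    qed
    then have "y = \<one>" using k xp by auto
    then show ?thesis using int c h subC by auto
  qed
  then show ?thesis
    using subgroup.one_closed[OF H] subgroup.one_closed[OF mult_subgroups[OF C gx]]
    by (auto simp: set_mult_def)
qed

text \<open>A subgroup \<open>C\<close> of the \<open>p\<close>-torsion that is maximal among those meeting both \<open>H\<close> and \<open>K\<close>
  trivially is a common complement, since the torsion is not a union of two proper subgroups.\<close>

lemma (in comm_group) torsion_supplements_iso:
  fixes p :: nat
  assumes fin: "finite (carrier G)" and p: "prime p"
    and H: "subgroup H G" and K: "subgroup K G" and card: "card H = card K"
    and supH: "{x \<in> carrier G. x [^] p = \<one>} <#> H = carrier G"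
    and supK: "{x \<in> carrier G. x [^] p = \<one>} <#> K = carrier G"
  shows "G\<lparr>carrier := H\<rparr> \<cong> G\<lparr>carrier := K\<rparr>"
proof -
  define T where "T = {x \<in> carrier G. x [^] p = \<one>}"
  have T: "subgroup T G"
    by (rule subgroupI) (auto simp: T_def nat_pow_distrib nat_pow_inv intro: exI[of _ \<one>])
  define \<C> where "\<C> = {C. subgroup C G \<and> C \<subseteq> T \<and> C \<inter> H = {\<one>} \<and> C \<inter> K = {\<one>}}"
  have "\<C> \<subseteq> Pow (carrier G)" unfolding \<C>_def by (auto dest: subgroup.subset)
  then have "finite \<C>" using fin by (meson finite_Pow_iff finite_subset)
  moreover have "{\<one>} \<in> \<C>"
    using subgroup.one_closed[OF T] subgroup.one_closed[OF H] subgroup.one_closed[OF K]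
    by (simp add: \<C>_def triv_subgroup)
  ultimately obtain C where C\<C>: "C \<in> \<C>" and max: "\<And>D. D \<in> \<C> \<Longrightarrow> C \<subseteq> D \<Longrightarrow> C = D"
    using finite_has_maximal[of \<C>] by blast
  have C: "subgroup C G" "C \<subseteq> T" "C \<inter> H = {\<one>}" "C \<inter> K = {\<one>}"
    using C\<C> by (auto simp: \<C>_def)
  \<comment> \<open>The subgroup \<open>C <#> L\<close> contains \<open>L\<close> anyway; once it
    also contains \<open>T\<close>, it contains \<open>T <#> L\<close>, which is everything.\<close>
  have prod: "C <#> L = carrier G" if "T \<subseteq> C <#> L" "subgroup L G" "T <#> L = carrier G" for L
  proof -
    have CL: "subgroup (C <#> L) G" using C that by (simp add: mult_subgroups)
    have "L \<subseteq> C <#> L"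
      using subgroup.one_closed[OF C(1)] subgroup.mem_carrier[OF that(2)]
      by (force simp: set_mult_def)
    then have "T <#> L \<subseteq> C <#> L"
      using that(1) subgroup.m_closed[OF CL] by (auto simp: set_mult_def[of G T])
    then show ?thesis using that(3) subgroup.subset[OF CL] by auto
  qed
  have cards: "card (C <#> H) = card (C <#> K)"
    using C H K card by (simp add: card_set_mult_disjoint)
  have CHK: "subgroup (C <#> H) G" "subgroup (C <#> K) G"
    using C H K by (simp_all add: mult_subgroups)
  have "T \<subseteq> C <#> H \<or> T \<subseteq> C <#> K"
  proof (rule subgroup_subset_Un[OF T CHK], rule ccontr)
    assume "\<not> T \<subseteq> (C <#> H) \<union> (C <#> K)"
    then obtain x where x: "x \<in> T" "x \<notin> C <#> H" "x \<notin> C <#> K" by blast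
    \<comment> \<open>Since \<open>x\<close> avoids both products, \<open>complement_extend\<close>
      applies to \<open>H\<close> and to \<open>K\<close>, so \<open>?D\<close> is again in the
      family. Maximality then forces \<open>x\<close> into \<open>C\<close>, and thus into
      \<open>C <#> H\<close>.\<close>
    let ?D = "C <#> generate G {x}"
    have xc: "x \<in> carrier G" "x [^] p = \<one>" using x by (auto simp: T_def)
    have gx: "subgroup (generate G {x}) G" "generate G {x} \<subseteq> T"
      using xc x T by (simp_all add: generate_is_subgroup generate_subgroup_incl)
    have "?D \<in> \<C>"
      using complement_extend[OF p C(1) H C(3) xc x(2)] complement_extend[OF p C(1) K C(4) xc x(3)]
        mult_subgroups[OF C(1) gx(1)] mono_set_mult[OF C(2) gx(2), of G] subgroup_mult_id[OF T]
      by (simp add: \<C>_def)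
    moreover have "C \<subseteq> ?D" "x \<in> ?D"
      using subgroup.one_closed[OF C(1)] subgroup.one_closed[OF gx(1)] xc
        subgroup.mem_carrier[OF C(1)] generate.incl[of x "{x}" G]
      by (force simp: set_mult_def)+
    ultimately have "x \<in> C" using max by blast
    moreover have "C \<subseteq> C <#> H"
      using subgroup.one_closed[OF H] subgroup.mem_carrier[OF C(1)] by (force simp: set_mult_def)
    ultimately show False using x by blast
  qed
  then have "C <#> H = carrier G \<or> C <#> K = carrier G"
    using prod H K supH supK unfolding T_def by blast
  \<comment> \<open>Both products have the same finite order, so as soon as one of them is the whole
    group, so is the other.\<close>
  then have "C <#> H = carrier G" "C <#> K = carrier G"
    using cards CHK[THEN subgroup.subset] fin by (metis card_subset_eq)+
  then have "G\<lparr>carrier := H\<rparr> \<cong> G Mod C" "G\<lparr>carrier := K\<rparr> \<cong> G Mod C"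
    using C H K by (simp_all add: complement_iso_FactGroup)
  then show ?thesis
    using iso_trans group.iso_sym[OF subgroup.subgroup_is_group[OF K is_group]] by metis
qed

section \<open>Abelian retracts and the abelianization\<close>

text \<open>The retraction \<open>f\<close> has an abelian target and so kills the derived subgroup.
  It is therefore constant on the cosets of that subgroup, and applying it to \<open>i a\<close> and
  \<open>i b\<close> recovers \<open>a\<close> and \<open>b\<close>.\<close>

lemma (in group) inj_on_abelianization:
  assumes A: "comm_group A" and i: "i \<in> hom A G" and f: "f \<in> hom G A"
    and fi: "\<And>a. a \<in> carrier A \<Longrightarrow> f (i a) = a"
  shows "inj_on (\<lambda>a. derived G (carrier G) #> i a) (carrier A)"
proof (rule inj_onI)
  fix a b assume ab: "a \<in> carrier A" "b \<in> carrier A"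
    and eq: "derived G (carrier G) #> i a = derived G (carrier G) #> i b"
  interpret A: comm_group A by fact
  interpret f: group_hom G A f
    using f by (intro group_hom.intro group_hom_axioms.intro is_group A.is_group)
  interpret D: normal "derived G (carrier G)" G by (rule derived_self_is_normal)
  have "f ` carrier G \<subseteq> carrier A" using f by (simp add: hom_def Pi_iff image_subset_iff)
  then have "f ` derived G (carrier G) = {\<one>\<^bsub>A\<^esub>}"
    using f.derived_img[OF order_refl] A.derived_eq_singleton by simp
  then have ker: "f d = \<one>\<^bsub>A\<^esub>" if "d \<in> derived G (carrier G)" for d
    using imageI[OF that, of f] by simp
  have iab: "i a \<in> carrier G" "i b \<in> carrier G" using ab i by (auto simp: hom_def)
  then have "i a \<in> derived G (carrier G) #> i b"
    unfolding eq[symmetric] by (intro rcos_self D.subgroup_axioms)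
  then obtain d where "d \<in> derived G (carrier G)" "i a = d \<otimes> i b"
    by (auto simp: r_coset_def)
  then have "f (i a) = f (i b)" using ker iab ab fi by simp
  then show "a = b" using fi ab by simp
qed

text \<open>Prepares the hypotheses of \<open>torsion_supplements_iso\<close>: \<open>S\<close> is
  the image of \<open>A\<close> under \<open>i\<close> followed by the projection. The projection
  sends the factor \<open>v\<close> supplied by \<open>sup\<close> to an element killed by
  \<open>p\<close>, so the torsion and \<open>S\<close> together fill the quotient.\<close>

lemma (in group) abelianization_retract:
  fixes p :: nat
  defines "D \<equiv> derived G (carrier G)"
  assumes A: "comm_group A" and i: "i \<in> hom A G" and f: "f \<in> hom G A"
    and fi: "\<And>a. a \<in> carrier A \<Longrightarrow> f (i a) = a"
    and sup: "\<And>x. x \<in> carrier G \<Longrightarrow>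
      \<exists>v\<in>carrier G. \<exists>a\<in>carrier A. v [^] p = \<one> \<and> x = v \<otimes> i a"
  obtains S where "subgroup S (G Mod D)" "A \<cong> (G Mod D)\<lparr>carrier := S\<rparr>"
    "card S = card (carrier A)"
    "{X \<in> carrier (G Mod D). X [^]\<^bsub>G Mod D\<^esub> p = \<one>\<^bsub>G Mod D\<^esub>} <#>\<^bsub>G Mod D\<^esub> S = carrier (G Mod D)"
proof -
  define Q where "Q = G Mod D"
  define \<pi> where "\<pi> = (\<lambda>x. D #> x)"
  define k where "k = (\<lambda>a. \<pi> (i a))"
  define T where "T = {X \<in> carrier Q. X [^]\<^bsub>Q\<^esub> p = \<one>\<^bsub>Q\<^esub>}"
  interpret A: comm_group A by fact
  interpret Q: comm_group Q unfolding Q_def D_def by (rule derived_quot_is_comm_group)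
  interpret D: normal D G unfolding D_def by (rule derived_self_is_normal)
  have \<pi>: "\<pi> \<in> hom G Q" unfolding \<pi>_def Q_def by (rule D.r_coset_hom_Mod)
  interpret \<pi>: group_hom G Q \<pi> by unfold_locales (rule \<pi>)
  have Q_car: "carrier Q = \<pi> ` carrier G"
    by (auto simp: Q_def \<pi>_def FactGroup_def RCOSETS_def)
  have hom: "k \<in> hom A Q"
    using Group.hom_compose[OF i \<pi>] by (simp add: k_def comp_def)
  interpret k: group_hom A Q k by unfold_locales (rule hom)
  have inj: "inj_on k (carrier A)"
    using inj_on_abelianization[OF A i f fi] by (simp add: k_def \<pi>_def D_def)
  have "k \<in> iso A (Q\<lparr>carrier := k ` carrier A\<rparr>)"
    using inj by (simp add: iso_def hom_def bij_betw_def)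
  then have iso: "A \<cong> Q\<lparr>carrier := k ` carrier A\<rparr>" unfolding is_iso_def by blast
  have "y \<in> T <#>\<^bsub>Q\<^esub> k ` carrier A" if "y \<in> carrier Q" for y
  proof -
    have "y \<in> \<pi> ` carrier G" using that by (simp only: Q_car)
    then obtain x where x: "y = \<pi> x" "x \<in> carrier G" by (rule imageE)
    obtain v a where va: "v \<in> carrier G" "a \<in> carrier A" "v [^] p = \<one>" "x = v \<otimes> i a"
      using sup[OF x(2)] by (elim bexE conjE)
    have "i a \<in> carrier G" using i va(2) by (rule hom_in_carrier)
    then have "y = \<pi> v \<otimes>\<^bsub>Q\<^esub> k a" using x(1) va by (simp add: k_def)
    moreover have "\<pi> v \<in> T"
      using \<pi>.hom_nat_pow[OF va(1), of p] va(1,3) by (simp add: T_def)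
    ultimately show ?thesis using va(2) unfolding set_mult_def by blast
  qed
  moreover have "T <#>\<^bsub>Q\<^esub> k ` carrier A \<subseteq> carrier Q"
    by (rule Q.set_mult_closed) (auto simp: T_def)
  ultimately have "T <#>\<^bsub>Q\<^esub> k ` carrier A = carrier Q" by blast
  then show ?thesis
    using that[of "k ` carrier A"] k.img_is_subgroup iso card_image[OF inj]
    unfolding Q_def T_def by blast
qed

text \<open>The images of both retracts lie in the same finite abelian group, the abelianization of
  \<open>G\<close>, where their orders agree and \<open>torsion_supplements_iso\<close> compares
  them.\<close>

lemma (in group) retracts_iso:
  fixes p :: nat
  assumes fin: "finite (carrier G)" and p: "prime p"
    and A: "comm_group A" "i \<in> hom A G" "f \<in> hom G A" "\<And>a. a \<in> carrier A \<Longrightarrow> f (i a) = a"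
    and B: "comm_group B" "j \<in> hom B G" "g \<in> hom G B" "\<And>b. b \<in> carrier B \<Longrightarrow> g (j b) = b"
    and supA: "\<And>x. x \<in> carrier G \<Longrightarrow>
      \<exists>v\<in>carrier G. \<exists>a\<in>carrier A. v [^] p = \<one> \<and> x = v \<otimes> i a"
    and supB: "\<And>x. x \<in> carrier G \<Longrightarrow>
      \<exists>v\<in>carrier G. \<exists>b\<in>carrier B. v [^] p = \<one> \<and> x = v \<otimes> j b"
    and card: "card (carrier A) = card (carrier B)"
  shows "A \<cong> B"
proof -
  let ?Q = "G Mod derived G (carrier G)"
  interpret Q: comm_group ?Q by (rule derived_quot_is_comm_group)
  have finQ: "finite (carrier ?Q)" using fin by (simp add: FactGroup_def RCOSETS_def)
  obtain S where S: "subgroup S ?Q" "A \<cong> ?Q\<lparr>carrier := S\<rparr>" "card S = card (carrier A)"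
    "{X \<in> carrier ?Q. X [^]\<^bsub>?Q\<^esub> p = \<one>\<^bsub>?Q\<^esub>} <#>\<^bsub>?Q\<^esub> S = carrier ?Q"
    by (rule abelianization_retract[OF A supA])
  obtain T where T: "subgroup T ?Q" "B \<cong> ?Q\<lparr>carrier := T\<rparr>" "card T = card (carrier B)"
    "{X \<in> carrier ?Q. X [^]\<^bsub>?Q\<^esub> p = \<one>\<^bsub>?Q\<^esub>} <#>\<^bsub>?Q\<^esub> T = carrier ?Q"
    by (rule abelianization_retract[OF B supB])
  have "?Q\<lparr>carrier := S\<rparr> \<cong> ?Q\<lparr>carrier := T\<rparr>"
    by (rule Q.torsion_supplements_iso[OF finQ p S(1) T(1) _ S(4) T(4)]) (simp add: S(3) T(3) card)
  then have "A \<cong> ?Q\<lparr>carrier := T\<rparr>" by (rule iso_trans[OF S(2)])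
  then show ?thesis
    by (rule iso_trans) (rule group.iso_sym[OF comm_group.axioms(2)[OF B(1)] T(2)])
qed

section \<open>Relative holomorphs as split extensions\<close>

text \<open>Automorphisms fix the identity, so no twist appears in the first component. Together
  with \<open>rel_holomorph_snd_hom\<close> this exhibits \<open>H\<close> as a retract of its
  holomorph.\<close>

lemma rel_holomorph_inject_hom:
  assumes "group G" "subgroup H (AutoGroup G)"
  shows "(\<lambda>h. (\<one>\<^bsub>G\<^esub>, h)) \<in> hom (AutoGroup G\<lparr>carrier := H\<rparr>) (rel_holomorph G H)"
proof -
  interpret G: group G by fact
  have one: "h \<one>\<^bsub>G\<^esub> = \<one>\<^bsub>G\<^esub>" if "h \<in> H" for h
  proof -
    have "h \<in> hom G G"
      using subgroup.subset[OF assms(2)] that by (auto simp: AutoGroup_simps auto_def)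
    then show ?thesis by (simp add: hom_one G.is_group)
  qed
  show ?thesis
  proof (rule homI)
    fix h k assume "h \<in> carrier (AutoGroup G\<lparr>carrier := H\<rparr>)"
    then have "h \<one>\<^bsub>G\<^esub> = \<one>\<^bsub>G\<^esub>" using one by simp
    then show "(\<one>\<^bsub>G\<^esub>, h \<otimes>\<^bsub>AutoGroup G\<lparr>carrier := H\<rparr>\<^esub> k)
        = (\<one>\<^bsub>G\<^esub>, h) \<otimes>\<^bsub>rel_holomorph G H\<^esub> (\<one>\<^bsub>G\<^esub>, k)"
      by (simp add: rel_holomorph_def)
  qed (simp add: rel_holomorph_def)
qed

lemma rel_holomorph_snd_hom:
  "snd \<in> hom (rel_holomorph G H) (AutoGroup G\<lparr>carrier := H\<rparr>)"
  by (auto simp: hom_def rel_holomorph_def)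

lemma rel_holomorph_decompose:
  assumes "group G" "subgroup H (AutoGroup G)" "v \<in> carrier G" "h \<in> H"
  shows "(v, h) = (v, \<one>\<^bsub>AutoGroup G\<^esub>) \<otimes>\<^bsub>rel_holomorph G H\<^esub> (\<one>\<^bsub>G\<^esub>, h)"
proof -
  interpret G: group G by fact
  interpret A: group "AutoGroup G" by (rule G.AutoGroup)
  have "\<one>\<^bsub>AutoGroup G\<^esub> \<otimes>\<^bsub>AutoGroup G\<^esub> h = h"
    using subgroup.mem_carrier[OF assms(2,4)] by simp
  then show ?thesis
    using assms by (simp add: rel_holomorph_def) (simp add: AutoGroup_simps)
qed

text \<open>Within the base the twist is by the identity automorphism; hence an exponent of
  \<open>G\<close> carries over to its copy in the holomorph.\<close>

lemma rel_holomorph_pow: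
  assumes "group G" "v \<in> carrier G"
  shows "(v, \<one>\<^bsub>AutoGroup G\<^esub>) [^]\<^bsub>rel_holomorph G H\<^esub> (n::nat) = (v [^]\<^bsub>G\<^esub> n, \<one>\<^bsub>AutoGroup G\<^esub>)"
proof (induction n)
  case 0
  then show ?case by (simp add: rel_holomorph_def)
next
  case (Suc n)
  interpret G: group G by fact
  interpret A: group "AutoGroup G" by (rule G.AutoGroup)
  have "\<one>\<^bsub>AutoGroup G\<^esub> v = v" using assms by (simp add: AutoGroup_simps)
  then show ?case using Suc by (simp add: rel_holomorph_def)
qed

text \<open>Everything is moved into the holomorph of \<open>K\<close>. There \<open>K\<close> is a
  retract by construction, and \<open>H\<close> becomes one through the isomorphism, with retraction
  \<open>snd \<circ> \<psi>\<close>.\<close>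

lemma (in group) rel_holomorph_iso_imp_iso:
  fixes p :: nat
  assumes fin: "finite (carrier G)" and p: "prime p"
    and exp: "\<And>v. v \<in> carrier G \<Longrightarrow> v [^] p = \<one>"
    and H: "subgroup H (AutoGroup G)" "comm_group (AutoGroup G\<lparr>carrier := H\<rparr>)"
    and K: "subgroup K (AutoGroup G)" "comm_group (AutoGroup G\<lparr>carrier := K\<rparr>)"
    and iso: "rel_holomorph G H \<cong> rel_holomorph G K"
  shows "AutoGroup G\<lparr>carrier := H\<rparr> \<cong> AutoGroup G\<lparr>carrier := K\<rparr>"
proof -
  let ?RH = "rel_holomorph G H" and ?RK = "rel_holomorph G K"
  interpret RH: group ?RH using H by (intro group_rel_holomorph is_group)
  interpret RK: group ?RK using K by (intro group_rel_holomorph is_group)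
  obtain \<phi> where \<phi>: "\<phi> \<in> iso ?RH ?RK" using iso by (auto simp: is_iso_def)
  define \<psi> where "\<psi> = inv_into (carrier ?RH) \<phi>"
  have \<psi>: "\<psi> \<in> iso ?RK ?RH" unfolding \<psi>_def using \<phi> by (rule RH.iso_set_sym)
  have \<psi>\<phi>: "\<psi> (\<phi> x) = x" if "x \<in> carrier ?RH" for x
    using \<phi> that by (auto simp: \<psi>_def iso_def bij_betw_def)
  have \<phi>\<psi>: "\<phi> (\<psi> x) = x" if "x \<in> carrier ?RK" for x
    using \<phi> that by (auto simp: \<psi>_def iso_def bij_betw_def f_inv_into_f)
  have \<phi>h: "\<phi> \<in> hom ?RH ?RK" and \<psi>h: "\<psi> \<in> hom ?RK ?RH"
    using \<phi> \<psi> by (auto simp: iso_def)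
  have sup: "\<exists>v\<in>carrier (rel_holomorph G L). \<exists>a\<in>carrier (AutoGroup G\<lparr>carrier := L\<rparr>).
      v [^]\<^bsub>rel_holomorph G L\<^esub> p = \<one>\<^bsub>rel_holomorph G L\<^esub> \<and>
      x = v \<otimes>\<^bsub>rel_holomorph G L\<^esub> (\<one>, a)"
    if L: "subgroup L (AutoGroup G)" and x: "x \<in> carrier (rel_holomorph G L)" for L x
  proof -
    obtain v h where vh: "x = (v, h)" "v \<in> carrier G" "h \<in> L"
      using x by (auto simp: rel_holomorph_def)
    have "(v, \<one>\<^bsub>AutoGroup G\<^esub>) \<in> carrier (rel_holomorph G L)"
      using vh subgroup.one_closed[OF L] by (simp add: rel_holomorph_def)
    moreover have "(v, \<one>\<^bsub>AutoGroup G\<^esub>) [^]\<^bsub>rel_holomorph G L\<^esub> p = \<one>\<^bsub>rel_holomorph G L\<^esub>"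
      using rel_holomorph_pow[OF is_group vh(2), of L p] exp[OF vh(2)]
      by (simp add: rel_holomorph_def)
    ultimately show ?thesis
      using rel_holomorph_decompose[OF is_group L vh(2,3)] vh by auto
  qed
  \<comment> \<open>Extensionality matters here: with values fixed outside the carrier, there are
    only finitely many self-maps of a finite carrier, whatever the size of the type.\<close>
  have "auto G \<subseteq> extensional (carrier G) \<inter> (carrier G \<rightarrow> carrier G)"
    by (auto simp: auto_def Bij_def bij_betw_def)
  then have "finite (auto G)"
    using fin by (metis PiE_def finite_PiE finite_subset Int_commute)
  then have finRK: "finite (carrier ?RK)"
    using fin K(1)[THEN subgroup.subset] finite_subset
    by (auto simp: rel_holomorph_def AutoGroup_simps)
  \<comment> \<open>Isomorphic holomorphs have equal order; cancelling the positive finite order of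
    \<open>G\<close> leaves the orders of \<open>H\<close> and \<open>K\<close>.\<close>
  have "card (carrier G \<times> H) = card (carrier G \<times> K)"
    using iso_same_card[OF iso] by (simp add: rel_holomorph_def)
  moreover have "card (carrier G) > 0" using fin one_closed by (auto simp: card_gt_0_iff)
  ultimately have card: "card H = card K" by (simp add: card_cartesian_product)
  show ?thesis
  proof (rule RK.retracts_iso[OF finRK p H(2) _ _ _ K(2) _ rel_holomorph_snd_hom])
    show "\<phi> \<circ> (\<lambda>h. (\<one>, h)) \<in> hom (AutoGroup G\<lparr>carrier := H\<rparr>) ?RK"
      using rel_holomorph_inject_hom[OF is_group H(1)] \<phi>h by (rule Group.hom_compose)
    show "snd \<circ> \<psi> \<in> hom ?RK (AutoGroup G\<lparr>carrier := H\<rparr>)"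
      using \<psi>h rel_holomorph_snd_hom by (rule Group.hom_compose)
    show "(\<lambda>h. (\<one>, h)) \<in> hom (AutoGroup G\<lparr>carrier := K\<rparr>) ?RK"
      using rel_holomorph_inject_hom[OF is_group K(1)] .
    show "(snd \<circ> \<psi>) ((\<phi> \<circ> (\<lambda>h. (\<one>, h))) a) = a"
      if "a \<in> carrier (AutoGroup G\<lparr>carrier := H\<rparr>)" for a
      using that \<psi>\<phi> by (simp add: rel_holomorph_def)
  next
    fix x assume x: "x \<in> carrier ?RK"
    \<comment> \<open>The factorization is made in the holomorph of \<open>H\<close> and pushed
      forward by \<open>\<phi>\<close>, which preserves the relation on the \<open>p\<close>-th
      power.\<close>
    then have \<psi>x: "\<psi> x \<in> carrier ?RH" using \<psi>h by (auto simp: hom_def)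
    then obtain v a where va: "v \<in> carrier ?RH" "a \<in> carrier (AutoGroup G\<lparr>carrier := H\<rparr>)"
      "v [^]\<^bsub>?RH\<^esub> p = \<one>\<^bsub>?RH\<^esub>" "\<psi> x = v \<otimes>\<^bsub>?RH\<^esub> (\<one>, a)"
      using sup[OF H(1) \<psi>x] by (elim bexE conjE)
    interpret \<phi>: group_hom ?RH ?RK \<phi> by unfold_locales (rule \<phi>h)
    have "(\<one>, a) \<in> carrier ?RH" using va by (simp add: rel_holomorph_def)
    then have "x = \<phi> v \<otimes>\<^bsub>?RK\<^esub> (\<phi> \<circ> (\<lambda>h. (\<one>, h))) a"
      using va \<phi>\<psi>[OF x] by simp
    moreover have "\<phi> v [^]\<^bsub>?RK\<^esub> p = \<one>\<^bsub>?RK\<^esub>"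
      using \<phi>.hom_nat_pow[OF va(1), of p] va(3) by simp
    ultimately show "\<exists>v\<in>carrier ?RK. \<exists>a\<in>carrier (AutoGroup G\<lparr>carrier := H\<rparr>).
        v [^]\<^bsub>?RK\<^esub> p = \<one>\<^bsub>?RK\<^esub> \<and> x = v \<otimes>\<^bsub>?RK\<^esub> (\<phi> \<circ> (\<lambda>h. (\<one>, h))) a"
      using \<phi>.hom_closed[OF va(1)] va(2)
      by (intro bexI[of _ "\<phi> v"] bexI[of _ a] conjI)
  next
    fix x assume "x \<in> carrier ?RK"
    then show "\<exists>v\<in>carrier ?RK. \<exists>a\<in>carrier (AutoGroup G\<lparr>carrier := K\<rparr>).
        v [^]\<^bsub>?RK\<^esub> p = \<one>\<^bsub>?RK\<^esub> \<and> x = v \<otimes>\<^bsub>?RK\<^esub> (\<one>, a)"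
      by (rule sup[OF K(1)])
  qed (simp_all add: card)
qed

section \<open>Vector spaces over the prime field\<close>

text \<open>Every vector is a combination of a finite spanning set \<open>A\<close>. Restricting the
  coefficients to \<open>A\<close> does not change the combination, and leaves only finitely many
  coefficient functions.\<close>

lemma (in vectorspace) finite_carrier:
  assumes "fin_dim" and fin: "finite (carrier K)"
  shows "finite (carrier V)"
proof -
  obtain A where A: "finite A" "A \<subseteq> carrier V" "span A = carrier V"
    using assms(1) by (auto simp: fin_dim_def)
  have "carrier V \<subseteq> (\<lambda>a. lincomb a A) ` (A \<rightarrow>\<^sub>E carrier K)"
  proof
    fix v assume "v \<in> carrier V"
    then have "v \<in> {lincomb a A |a. a \<in> A \<rightarrow> carrier K}"
      using A(3) finite_span[OF A(1,2)] by simp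
    then obtain a where a: "a \<in> A \<rightarrow> carrier K" "v = lincomb a A" by blast
    then have "v = lincomb (restrict a A) A"
      using A(2) by (auto simp: lincomb_def Pi_iff intro!: M.finsum_cong')
    then show "v \<in> (\<lambda>a. lincomb a A) ` (A \<rightarrow>\<^sub>E carrier K)" using a by auto
  qed
  then show ?thesis using A fin by (meson finite_PiE finite_imageI finite_subset)
qed

text \<open>Moves repeated addition of a vector into the scalars, so that the characteristic of the
  field bounds the exponent of the additive group.\<close>

lemma (in module) add_pow_smult:
  assumes "v \<in> carrier M"
  shows "add_pow M (n::nat) v = add_pow R n \<one>\<^bsub>R\<^esub> \<odot>\<^bsub>M\<^esub> v"
  by (induction n) (use assms in \<open>simp_all add: smult_l_distr\<close>)

theorem proposition5p3:
  fixes F :: "('f, 'k) ring_scheme"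
    and V :: "('f, 'v, 'm) module_scheme"
    and H K :: "('v \<Rightarrow> 'v) set"
    and p n :: nat
  assumes "prime p"
    and "field F" and "card (carrier F) = p"
    and "vectorspace F V" and "vectorspace.fin_dim F V"
    and "vectorspace.dim F V = n" and "n > 0"
    and "subgroup H (general_linear_group F V)"
    and "subgroup K (general_linear_group F V)"
    and "comm_group (general_linear_group F V \<lparr>carrier := H\<rparr>)"
    and "comm_group (general_linear_group F V \<lparr>carrier := K\<rparr>)"
    and "rel_holomorph (add_monoid V) H \<cong> rel_holomorph (add_monoid V) K"
  shows "general_linear_group F V \<lparr>carrier := H\<rparr> \<cong> general_linear_group F V \<lparr>carrier := K\<rparr>"
proof -
  interpret vectorspace F V by fact
  \<comment> \<open>An infinite set has \<open>card\<close> equal to 0, which is not prime.\<close>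
  have finF: "finite (carrier F)"
    using assms(1,3) by (metis card.infinite not_prime_0)
  have exp: "v [^]\<^bsub>add_monoid V\<^esub> p = \<one>\<^bsub>add_monoid V\<^esub>" if "v \<in> carrier (add_monoid V)" for v
  proof -
    \<comment> \<open>The additive group of \<open>F\<close> has order \<open>p\<close>, so Lagrange
      gives this multiple of one.\<close>
    have "add_pow F p \<one>\<^bsub>F\<^esub> = \<zero>\<^bsub>F\<^esub>"
      using group.pow_order_eq_1[OF R.add.is_group, of "\<one>\<^bsub>F\<^esub>"] assms(3)
      by (simp add: order_def add_pow_def)
    then show ?thesis using add_pow_smult[of v "p"] that by (simp add: add_pow_def)
  qed
  have "finite (carrier (add_monoid V))" using finite_carrier[OF assms(5) finF] by simp
  \<comment> \<open>\<open>general_linear_group F V\<close> is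
    \<open>AutoGroup (add_monoid V)\<close> with a smaller carrier; overwriting the carrier by
    \<open>H\<close> or \<open>K\<close> gives the same group from either.\<close>
  then have "AutoGroup (add_monoid V)\<lparr>carrier := H\<rparr> \<cong> AutoGroup (add_monoid V)\<lparr>carrier := K\<rparr>"
    using assms(8-12)
    by (intro group.rel_holomorph_iso_imp_iso[OF M.add.is_group _ assms(1) exp]
        subgroup_general_linear_imp_subgroup_AutoGroup[OF module_axioms])
      (simp_all add: general_linear_group_eq)
  then show ?thesis by (simp add: general_linear_group_eq)
qed

end
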